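(* For every dense $G_\delta$ set $G\subseteq\omega^\omega\times\omega^\omega$ there exists a slalom perfect set $P\subseteq\omega^\omega$ satisfying $P\times P\subseteq G\cup\Delta$, where $\Delta=\{(x,x):x\in\omega^\omega\}$.
   Context: A tree is a nonempty set $T\subseteq\omega^{<\omega}=\bigcup_n\omega^n$ closed under initial segments, with body $[T]=\{x\in\omega^\omega:(\forall n)\ x\restriction n\in T\}$. It is perfect if every $\sigma\in T$ has an extension $\tau\in T$ with $\tau^\frown i,\tau^\frown j\in T$ for some $i\ne j$. A tree $T\subseteq\omega^{<\omega}$ is a slalom tree if for every $\sigma\in\omega^{<\omega}$ there is an interval $I\subseteq\omega$ such that for every $\tau\in T$, if $I\subseteq|\tau|=\{0,\dots,|\tau|-1\}$, then $\tau\restriction I=\sigma$. Here $\tau\restriction I=\sigma$ is understood up to shift: $I=\{m,m+1,\dots,m+|\sigma|-1\}$ and $\tau(m+i)=\sigma(i)$ for all $i<|\sigma|$. A set $P\subseteq\omega^\omega$ is slalom perfect if it is the body of a perfect slalom tree. *)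

theory Defs
  imports "HOL-Analysis.Analysis" "HOL-Library.Sublist"
begin

text \<open>
  Finite sequences are lists of naturals, with \<open>length \<tau>\<close> in the role of the domain
  \<open>{0, ..., |\<tau>| - 1}\<close>.  The Baire space is the type \<^typ>\<open>nat \<Rightarrow> nat\<close>: the library's
  type-class topology on it is the product of the discrete topologies.
\<close>

definition is_tree :: "nat list set \<Rightarrow> bool" where
  "is_tree T \<longleftrightarrow> T \<noteq> {} \<and> (\<forall>\<tau>\<in>T. \<forall>\<sigma>. prefix \<sigma> \<tau> \<longrightarrow> \<sigma> \<in> T)"

definition body :: "nat list set \<Rightarrow> (nat \<Rightarrow> nat) set" where
  "body T = {x. \<forall>n. map x [0..<n] \<in> T}"

definition perfect_tree :: "nat list set \<Rightarrow> bool" where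
  "perfect_tree T \<longleftrightarrow> is_tree T \<and>
    (\<forall>\<sigma>\<in>T. \<exists>\<tau>\<in>T. prefix \<sigma> \<tau> \<and> (\<exists>i j. i \<noteq> j \<and> \<tau> @ [i] \<in> T \<and> \<tau> @ [j] \<in> T))"

text \<open>
  The interval is \<open>I = {m..<m + length \<sigma>}\<close>.  The same \<open>I\<close> must work for all nodes of \<open>T\<close>
  that are long enough to contain it.
\<close>

definition slalom_tree :: "nat list set \<Rightarrow> bool" where
  "slalom_tree T \<longleftrightarrow> is_tree T \<and>
    (\<forall>\<sigma>. \<exists>m. \<forall>\<tau>\<in>T. {m..<m + length \<sigma>} \<subseteq> {..<length \<tau>} \<longrightarrow>
      (\<forall>i<length \<sigma>. \<tau> ! (m + i) = \<sigma> ! i))"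

definition slalom_perfect :: "(nat \<Rightarrow> nat) set \<Rightarrow> bool" where
  "slalom_perfect P \<longleftrightarrow> (\<exists>T. perfect_tree T \<and> slalom_tree T \<and> P = body T)"

end

theory Submission
  imports Defs
begin

text \<open>
  The set \<open>P\<close> is produced by a fusion argument.  Write \<open>G = \<Inter>\<^sub>n U\<^sub>n\<close> with \<open>U\<^sub>n\<close> open and
  decreasing; each \<open>U\<^sub>n\<close> is dense because it contains \<open>G\<close>.  Build finite sets \<open>S\<^sub>0, S\<^sub>1, \<dots>\<close> of
  finite sequences, all members of \<open>S\<^sub>n\<close> having one common length, as follows.  To pass from
  \<open>S\<^sub>n\<close> to \<open>S\<^sub>n\<^sub>+\<^sub>1\<close>, split every member into two immediate successors.  There are only finitely many
  ordered pairs of distinct nodes now, so density of \<open>U\<^sub>n\<close> allows these nodes to be extended, one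
  pair after the other, until every product of two distinct cylinders lies in \<open>U\<^sub>n\<close>; shrinking
  a cylinder further never destroys this.  Finally pad all nodes to the same length and append to
  every one of them the \<open>n\<close>-th finite sequence \<open>\<sigma>\<^sub>n\<close> of a fixed enumeration
  (\<open>fusion_step\<close>).

  Let \<open>T\<close> consist of the initial segments of the members of all \<open>S\<^sub>n\<close>.  The splitting makes \<open>T\<close>
  perfect.  Since the lengths in \<open>S\<^sub>n\<^sub>+\<^sub>1\<close> agree, the copies of \<open>\<sigma>\<^sub>n\<close> all sit over the same
  interval, and every node of \<open>T\<close> that reaches the end of this interval passes through \<open>S\<^sub>n\<^sub>+\<^sub>1\<close>
  (\<open>take_mem_front\<close>); hence \<open>T\<close> is a slalom tree.  Two distinct branches of \<open>T\<close> pass through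
  distinct members of \<open>S\<^sub>n\<close> for all large \<open>n\<close>, so the pair they form is in \<open>U\<^sub>n\<close> for all large
  \<open>n\<close>, and therefore in \<open>G\<close>.
\<close>

section \<open>Cylinders in the Baire space\<close>

definition cylinder :: "nat list \<Rightarrow> (nat \<Rightarrow> nat) set" where
  "cylinder a = {x. map x [0..<length a] = a}"

lemma cylinder_iff: "x \<in> cylinder a \<longleftrightarrow> (\<forall>i<length a. x i = a ! i)"
proof -
  have "x \<in> cylinder a \<longleftrightarrow> map x [0..<length a] = map ((!) a) [0..<length a]"
    by (simp only: cylinder_def mem_Collect_eq map_nth)
  also have "\<dots> \<longleftrightarrow> (\<forall>i<length a. x i = a ! i)"
    unfolding map_eq_conv by auto
  finally show ?thesis .
qed

lemma cylinder_antimono: "prefix a b \<Longrightarrow> cylinder b \<subseteq> cylinder a"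
  by (force simp: cylinder_iff prefix_def nth_append)

lemma mem_cylinder_restrict: "x \<in> cylinder (map x [0..<n])"
  by (simp add: cylinder_iff)

lemma mem_cylinder_nth: "(\<lambda>i. if i < length a then a ! i else 0) \<in> cylinder a"
  by (simp add: cylinder_iff)

lemma prefix_restrict:
  assumes "x \<in> cylinder a" "length a \<le> n"
  shows "prefix a (map x [0..<n])"
proof -
  have "a = take (length a) (map x [0..<n])"
    using assms by (intro nth_equalityI) (simp_all add: cylinder_iff)
  then show ?thesis by (metis take_is_prefix)
qed

lemma open_cylinder: "open (cylinder a)"
proof -
  have "cylinder a = (\<Inter>i\<in>{..<length a}. (\<lambda>x. x i) -` {a ! i})"
    by (auto simp: cylinder_iff)
  moreover have "open ((\<lambda>x :: nat \<Rightarrow> nat. x i) -` {k})" for i k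
    by (rule open_vimage) (simp_all add: open_discrete)
  ultimately show ?thesis by auto
qed

lemma open_contains_cylinder:
  fixes U :: "(nat \<Rightarrow> nat) set"
  assumes "open U" "x \<in> U"
  obtains n where "cylinder (map x [0..<n]) \<subseteq> U"
proof -
  have "openin (product_topology (\<lambda>i. euclidean) UNIV) U"
    using assms(1) by (simp add: open_fun_def)
  from product_topology_open_contains_basis[OF this assms(2)]
  obtain X where X: "x \<in> (\<Pi>\<^sub>E i\<in>UNIV. X i)" "finite {i. X i \<noteq> (UNIV :: nat set)}"
      "(\<Pi>\<^sub>E i\<in>UNIV. X i) \<subseteq> U"
    unfolding topspace_euclidean by blast
  obtain n where n: "\<forall>i. X i \<noteq> UNIV \<longrightarrow> i < n"
    using X(2) unfolding finite_nat_set_iff_bounded by blast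
  have "y i \<in> X i" if "y \<in> cylinder (map x [0..<n])" for y i
  proof (cases "i < n")
    case True
    then have "y i = x i" using that by (simp add: cylinder_iff)
    then show ?thesis using X(1) by (auto simp: PiE_iff)
  next
    case False
    then show ?thesis using n by blast
  qed
  then have "cylinder (map x [0..<n]) \<subseteq> (\<Pi>\<^sub>E i\<in>UNIV. X i)"
    by (simp add: PiE_iff subset_iff)
  then have "cylinder (map x [0..<n]) \<subseteq> U"
    using X(3) by (rule subset_trans)
  then show ?thesis by (rule that)
qed

section \<open>Meeting a dense open set of pairs\<close>

text \<open>
  By density \<open>U\<close> contains a point of the open set \<open>cylinder a \<times> cylinder b\<close>; sufficiently long
  initial segments of its two coordinates are the required extensions.
\<close>

lemma dense_open_contains_cylinders:
  assumes "open U" "closure U = UNIV"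
  obtains a' b' where "prefix a a'" "prefix b b'" "cylinder a' \<times> cylinder b' \<subseteq> U"
proof -
  have "open (cylinder a \<times> cylinder b)" "cylinder a \<times> cylinder b \<noteq> {}"
    using mem_cylinder_nth by (auto intro!: open_Times open_cylinder)
  then obtain x y where xy: "x \<in> cylinder a" "y \<in> cylinder b" "(x, y) \<in> U"
    using open_Int_closure_eq_empty[of "cylinder a \<times> cylinder b" U] assms(2) by auto
  obtain A B where AB: "open A" "open B" "(x, y) \<in> A \<times> B" "A \<times> B \<subseteq> U"
    using open_prod_elim[OF assms(1) xy(3)] by metis
  obtain m where m: "cylinder (map x [0..<m]) \<subseteq> A"
    using open_contains_cylinder AB by blast
  obtain n where n: "cylinder (map y [0..<n]) \<subseteq> B"
    using open_contains_cylinder AB by blast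
  let ?k = "m + n + length a + length b"
  have "prefix (map x [0..<m]) (map x [0..<?k])" "prefix (map y [0..<n]) (map y [0..<?k])"
    by (auto intro!: prefix_restrict mem_cylinder_restrict)
  then have "cylinder (map x [0..<?k]) \<times> cylinder (map y [0..<?k]) \<subseteq> U"
    using m n AB(4) cylinder_antimono by blast
  moreover have "prefix a (map x [0..<?k])" "prefix b (map y [0..<?k])"
    using xy by (auto intro!: prefix_restrict)
  ultimately show ?thesis using that by blast
qed

text \<open>
  The pairs are treated one at a time.  Treating \<open>(a, b)\<close> lengthens the current extensions of
  \<open>a\<close> and \<open>b\<close>, which only shrinks the cylinders of the pairs already treated.  The new
  extensions of \<open>a\<close> and \<open>b\<close> are in general different, so one function can take both values
  only because \<open>a \<noteq> b\<close>.
\<close>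

lemma extend_pairs_into_dense_open:
  assumes "open U" "closure U = UNIV" "finite Q" "\<forall>(a, b)\<in>Q. a \<noteq> b"
  shows "\<exists>f. (\<forall>a. prefix a (f a)) \<and> (\<forall>(a, b)\<in>Q. cylinder (f a) \<times> cylinder (f b) \<subseteq> U)"
  using assms(3,4)
proof (induction Q rule: finite_induct)
  case empty
  show ?case by (rule exI[of _ id]) auto
next
  case (insert q Q)
  obtain a b where q: "q = (a, b)" "a \<noteq> b" using insert.prems by (cases q) auto
  obtain f where f: "\<And>c. prefix c (f c)"
      "\<And>c d. (c, d) \<in> Q \<Longrightarrow> cylinder (f c) \<times> cylinder (f d) \<subseteq> U"
    using insert.IH insert.prems by blast
  obtain a' b' where ab: "prefix (f a) a'" "prefix (f b) b'" "cylinder a' \<times> cylinder b' \<subseteq> U"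
    using dense_open_contains_cylinders assms(1,2) by blast
  define g where "g = f(a := a', b := b')"
  have fg: "prefix (f c) (g c)" for c
    using ab by (simp add: g_def)
  have "prefix c (g c)" for c
    using f(1) fg prefix_order.trans by blast
  moreover have "cylinder (g c) \<times> cylinder (g d) \<subseteq> U" if "(c, d) \<in> Q" for c d
    using f(2)[OF that] cylinder_antimono[OF fg] by blast
  moreover have "cylinder (g a) \<times> cylinder (g b) \<subseteq> U"
    using ab(3) q(2) by (simp add: g_def)
  ultimately show ?case unfolding q(1) by (intro exI[of _ g]) blast
qed

section \<open>Fusion\<close>

definition splits_over :: "nat list set \<Rightarrow> nat list \<Rightarrow> bool" where
  "splits_over S s \<longleftrightarrow> (\<exists>\<tau> i j. prefix s \<tau> \<and> i \<noteq> j \<and>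
     (\<exists>t\<in>S. prefix (\<tau> @ [i]) t) \<and> (\<exists>t\<in>S. prefix (\<tau> @ [j]) t))"

text \<open>
  One stage of the construction: \<open>S\<close> and \<open>S'\<close> are consecutive fronts, \<open>U\<close> is the dense open
  set treated at this stage, and \<open>\<sigma>\<close> is the sequence to be caught.  The last clause places
  \<open>\<sigma>\<close> at the very end of every node of \<open>S'\<close>, which also gives these nodes equal lengths.
\<close>

definition refines ::
  "((nat \<Rightarrow> nat) \<times> (nat \<Rightarrow> nat)) set \<Rightarrow> nat list \<Rightarrow> nat list set \<Rightarrow> nat list set \<Rightarrow> bool" where
  "refines U \<sigma> S S' \<longleftrightarrow>
     (\<forall>t\<in>S'. \<exists>s\<in>S. strict_prefix s t) \<and>
     (\<forall>s\<in>S. splits_over S' s) \<and>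
     (\<forall>a\<in>S'. \<forall>b\<in>S'. a \<noteq> b \<longrightarrow> cylinder a \<times> cylinder b \<subseteq> U) \<and>
     (\<exists>m. \<forall>t\<in>S'. length t = m + length \<sigma> \<and> drop m t = \<sigma>)"

lemma
  assumes "refines U \<sigma> S S'"
  shows refines_extends: "t \<in> S' \<Longrightarrow> \<exists>s\<in>S. strict_prefix s t"
    and refines_splits: "s \<in> S \<Longrightarrow> splits_over S' s"
    and refines_cylinders: "a \<in> S' \<Longrightarrow> b \<in> S' \<Longrightarrow> a \<noteq> b \<Longrightarrow> cylinder a \<times> cylinder b \<subseteq> U"
    and refines_end: "\<exists>m. \<forall>t\<in>S'. length t = m + length \<sigma> \<and> drop m t = \<sigma>"
  using assms unfolding refines_def by simp_all

text \<open>
  The extensions obtained for the split nodes are padded with zeros up to the greatest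
  occurring length, so that \<open>\<sigma>\<close> starts at the same position in all of them.
\<close>

lemma fusion_step:
  assumes "open U" "closure U = UNIV" "finite S" "S \<noteq> {}"
  shows "\<exists>S'. finite S' \<and> S' \<noteq> {} \<and> refines U \<sigma> S S'"
proof -
  define A where "A = (\<lambda>(s, i). s @ [i]) ` (S \<times> {0, 1 :: nat})"
  have finA: "finite A" using assms(3) by (simp add: A_def)
  have "finite {(a, b) \<in> A \<times> A. a \<noteq> b}"
    using finA by (auto intro: finite_subset[of _ "A \<times> A"])
  from extend_pairs_into_dense_open[OF assms(1,2) this]
  obtain f where f: "\<And>a. prefix a (f a)"
      "\<And>a b. a \<in> A \<Longrightarrow> b \<in> A \<Longrightarrow> a \<noteq> b \<Longrightarrow> cylinder (f a) \<times> cylinder (f b) \<subseteq> U"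
    by fastforce
  define L where "L = Max (length ` f ` A)"
  have L: "length (f a) \<le> L" if "a \<in> A" for a
    using finA that by (simp add: L_def)
  define g where "g a = f a @ replicate (L - length (f a)) 0 @ \<sigma>" for a
  have fg: "prefix (f a) (g a)" for a by (simp add: g_def)
  have ag: "prefix a (g a)" for a using f(1) fg prefix_order.trans by blast
  have "\<exists>s\<in>S. strict_prefix s t" if "t \<in> g ` A" for t
  proof -
    obtain s i where "s \<in> S" "t = g (s @ [i])" using \<open>t \<in> g ` A\<close> by (auto simp: A_def)
    moreover have "strict_prefix s (g (s @ [i]))"
      using ag[of "s @ [i]"] by (auto simp: strict_prefix_def prefix_def)
    ultimately show ?thesis by blast
  qed
  moreover have "splits_over (g ` A) s" if "s \<in> S" for s
  proof -
    have "s @ [0] \<in> A" "s @ [1] \<in> A" using that by (auto simp: A_def)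
    then show ?thesis unfolding splits_over_def
      using ag by (intro exI[of _ s] exI[of _ 0] exI[of _ 1]) auto
  qed
  moreover have "cylinder a \<times> cylinder b \<subseteq> U" if "a \<in> g ` A" "b \<in> g ` A" "a \<noteq> b" for a b
  proof -
    obtain c d where "c \<in> A" "d \<in> A" "a = g c" "b = g d" "c \<noteq> d"
      using \<open>a \<in> g ` A\<close> \<open>b \<in> g ` A\<close> \<open>a \<noteq> b\<close> by auto
    then show ?thesis
      using f(2) cylinder_antimono[OF fg] by blast
  qed
  moreover have "\<forall>t\<in>g ` A. length t = L + length \<sigma> \<and> drop L t = \<sigma>"
    by (auto simp: g_def dest!: L)
  ultimately have "refines U \<sigma> S (g ` A)" unfolding refines_def by blast
  moreover have "finite (g ` A)" "g ` A \<noteq> {}"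
    using finA assms(4) by (auto simp: A_def)
  ultimately show ?thesis by blast
qed

definition initial_segments :: "nat list set \<Rightarrow> nat list set" where
  "initial_segments S = {\<tau>. \<exists>t\<in>S. prefix \<tau> t}"

lemma is_tree_initial_segments: "S \<noteq> {} \<Longrightarrow> is_tree (initial_segments S)"
  by (auto simp: is_tree_def initial_segments_def intro: prefix_order.trans)

text \<open>
  Nonempty levels of constant length, each strictly extending the one before, already force
  every node of the generated tree to pass through all the levels that it is long enough to reach.
\<close>

locale fusion_fronts =
  fixes S :: "nat \<Rightarrow> nat list set" and l :: "nat \<Rightarrow> nat"
  assumes nonempty: "S n \<noteq> {}"
    and len: "t \<in> S n \<Longrightarrow> length t = l n"
    and ext: "t \<in> S (Suc n) \<Longrightarrow> \<exists>s\<in>S n. strict_prefix s t"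
begin

lemma front_lengths_strict_mono: "strict_mono l"
proof (rule strict_monoI_Suc)
  fix n
  obtain t s where "t \<in> S (Suc n)" "s \<in> S n" "strict_prefix s t"
    using nonempty ext by blast
  then show "l n < l (Suc n)" using len prefix_length_less by metis
qed

lemma take_mem_earlier_front: "n \<le> k \<Longrightarrow> t \<in> S k \<Longrightarrow> take (l n) t \<in> S n"
proof (induction k arbitrary: t rule: dec_induct)
  case base
  then show ?case using len by simp
next
  case (step k)
  obtain s where s: "s \<in> S k" "strict_prefix s t" using ext step.prems by blast
  have "l n \<le> length s"
    using front_lengths_strict_mono step.hyps(1) len[OF s(1)] by (simp add: strict_mono_less_eq)
  then have "take (l n) t = take (l n) s"
    using s(2) by (auto simp: strict_prefix_def prefix_def)
  then show ?case using step.IH s(1) by simp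
qed

text \<open>
  This turns statements about the members of one front into statements about all long nodes.
  A node of length at least \<open>l n\<close> cannot be an initial segment of a member of \<open>S k\<close> with \<open>k < n\<close>,
  as such a member is too short.
\<close>

lemma take_mem_front:
  assumes "\<tau> \<in> initial_segments (\<Union>k. S k)" "l n \<le> length \<tau>"
  shows "take (l n) \<tau> \<in> S n"
proof -
  obtain k t where t: "t \<in> S k" "prefix \<tau> t"
    using assms(1) by (auto simp: initial_segments_def)
  have "l n \<le> l k" using t assms(2) len prefix_length_le by (metis order.trans)
  then have "n \<le> k" using front_lengths_strict_mono by (simp add: strict_mono_less_eq)
  then have "take (l n) t \<in> S n" using take_mem_earlier_front t(1) by blast
  moreover have "take (l n) t = take (l n) \<tau>" using t(2) assms(2) by (auto simp: prefix_def)
  ultimately show ?thesis by simp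
qed

lemma branch_mem_front:
  assumes "x \<in> body (initial_segments (\<Union>k. S k))"
  shows "map x [0..<l n] \<in> S n"
proof -
  have "map x [0..<l n] \<in> initial_segments (\<Union>k. S k)" using assms by (simp add: body_def)
  from take_mem_front[OF this, of n] show ?thesis by simp
qed

lemma perfect_tree_fusion:
  assumes split: "\<And>n s. s \<in> S n \<Longrightarrow> splits_over (S (Suc n)) s"
  shows "perfect_tree (initial_segments (\<Union>k. S k))" (is "perfect_tree ?T")
  unfolding perfect_tree_def
proof (intro conjI ballI)
  show "is_tree ?T" using nonempty by (intro is_tree_initial_segments) auto
next
  fix \<sigma> assume "\<sigma> \<in> ?T"
  then obtain k s where s: "s \<in> S k" "prefix \<sigma> s" by (auto simp: initial_segments_def)
  obtain \<tau> i j where \<tau>: "prefix s \<tau>" "i \<noteq> j"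
      "\<exists>t\<in>S (Suc k). prefix (\<tau> @ [i]) t" "\<exists>t\<in>S (Suc k). prefix (\<tau> @ [j]) t"
    using split[OF s(1)] unfolding splits_over_def by blast
  have "\<tau> @ [i] \<in> ?T" "\<tau> @ [j] \<in> ?T"
    using \<tau>(3,4) unfolding initial_segments_def by blast+
  moreover from this have "\<tau> \<in> ?T"
    unfolding initial_segments_def using append_prefixD by blast
  moreover have "prefix \<sigma> \<tau>" using s(2) \<tau>(1) by (rule prefix_order.trans)
  ultimately show "\<exists>\<tau>\<in>?T. prefix \<sigma> \<tau> \<and> (\<exists>i j. i \<noteq> j \<and> \<tau> @ [i] \<in> ?T \<and> \<tau> @ [j] \<in> ?T)"
    using \<tau>(2) by blast
qed

lemma slalom_tree_fusion:
  assumes ends: "\<And>\<sigma>. \<exists>n m. \<forall>t\<in>S n. length t = m + length \<sigma> \<and> drop m t = \<sigma>"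
  shows "slalom_tree (initial_segments (\<Union>k. S k))" (is "slalom_tree ?T")
  unfolding slalom_tree_def
proof (intro conjI allI)
  show "is_tree ?T" using nonempty by (intro is_tree_initial_segments) auto
next
  fix \<sigma>
  obtain n m where nm: "\<And>t. t \<in> S n \<Longrightarrow> length t = m + length \<sigma> \<and> drop m t = \<sigma>"
    using ends by blast
  have ln: "l n = m + length \<sigma>" using nm nonempty[of n] len by fastforce
  have "\<tau> ! (m + i) = \<sigma> ! i"
    if \<tau>: "\<tau> \<in> ?T" "{m..<m + length \<sigma>} \<subseteq> {..<length \<tau>}" and i: "i < length \<sigma>" for \<tau> i
  proof -
    have "m + length \<sigma> - 1 \<in> {m..<m + length \<sigma>}" using i by auto
    then have "m + length \<sigma> - 1 < length \<tau>" using \<tau>(2) by blast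
    then have "l n \<le> length \<tau>" using ln i by linarith
    then have mem: "take (l n) \<tau> \<in> S n" using take_mem_front \<tau>(1) by blast
    have "\<sigma> ! i = drop m (take (l n) \<tau>) ! i" using nm[OF mem] by simp
    also have "\<dots> = \<tau> ! (m + i)" using \<open>l n \<le> length \<tau>\<close> ln i by simp
    finally show ?thesis by simp
  qed
  then show "\<exists>m. \<forall>\<tau>\<in>?T. {m..<m + length \<sigma>} \<subseteq> {..<length \<tau>} \<longrightarrow>
      (\<forall>i<length \<sigma>. \<tau> ! (m + i) = \<sigma> ! i)" by blast
qed

text \<open>
  The lengths \<open>l n\<close> are unbounded, so distinct branches \<open>x\<close> and \<open>y\<close> pass through distinct
  members of \<open>S n\<close> as soon as \<open>l n\<close> exceeds a place where they differ.  For the finitely many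
  earlier \<open>n\<close> the conclusion is inherited from a later one.
\<close>

lemma distinct_branches_mem_Inter:
  assumes "decseq U"
    and cyl: "\<And>n a b. a \<in> S (Suc n) \<Longrightarrow> b \<in> S (Suc n) \<Longrightarrow> a \<noteq> b \<Longrightarrow> cylinder a \<times> cylinder b \<subseteq> U n"
    and x: "x \<in> body (initial_segments (\<Union>k. S k))"
    and y: "y \<in> body (initial_segments (\<Union>k. S k))"
    and "x \<noteq> y"
  shows "(x, y) \<in> (\<Inter>n. U n)"
proof
  fix n
  obtain i where i: "x i \<noteq> y i" using \<open>x \<noteq> y\<close> by auto
  define k where "k = max n i"
  have "Suc k \<le> l (Suc k)" using front_lengths_strict_mono by (rule strict_mono_imp_increasing)
  then have "i < l (Suc k)" by (simp add: k_def)
  then have "map x [0..<l (Suc k)] \<noteq> map y [0..<l (Suc k)]" using i by auto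
  then have "(x, y) \<in> U k"
    using cyl branch_mem_front[OF x] branch_mem_front[OF y] mem_cylinder_restrict by blast
  moreover have "U k \<subseteq> U n" using \<open>decseq U\<close> by (simp add: decseq_def k_def)
  ultimately show "(x, y) \<in> U n" by blast
qed

end

section \<open>Slalom perfect sets inside dense \<open>G\<^sub>\<delta>\<close> relations\<close>

lemma gdelta_decseq:
  assumes "gdelta G"
  obtains U :: "nat \<Rightarrow> 'a::topological_space set"
    where "\<And>n. open (U n)" "decseq U" "G = (\<Inter>n. U n)"
proof -
  obtain F :: "nat \<Rightarrow> 'a set" where F: "\<And>n. open (F n)" "G = \<Inter>(F ` UNIV)"
    using assms by (auto elim: gdelta.cases)
  show ?thesis
  proof (rule that[of "\<lambda>n. \<Inter>i\<le>n. F i"])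
    show "decseq (\<lambda>n. \<Inter>i\<le>n. F i)" by (force simp: decseq_def)
  qed (use F in auto)
qed

theorem theorem17:
  fixes G :: "((nat \<Rightarrow> nat) \<times> (nat \<Rightarrow> nat)) set"
  assumes "gdelta G" and "closure G = UNIV"
  shows "\<exists>P :: (nat \<Rightarrow> nat) set. slalom_perfect P \<and> P \<times> P \<subseteq> G \<union> Id"
proof -
  obtain U where U: "\<And>n. open (U n)" "decseq U" "G = (\<Inter>n. U n)"
    using gdelta_decseq[OF assms(1)] by blast
  have dense: "closure (U n) = UNIV" for n
  proof -
    have "closure G \<subseteq> closure (U n)" using U(3) by (intro closure_mono) auto
    then show ?thesis using assms(2) by auto
  qed
  have "\<exists>S. \<forall>n. (finite (S n) \<and> S n \<noteq> {} \<and> (n = 0 \<longrightarrow> S n = {[]})) \<and>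
      refines (U n) (from_nat n) (S n) (S (Suc n))"
  proof (rule dependent_nat_choice)
    show "\<exists>S. finite S \<and> S \<noteq> {} \<and> (0 = (0::nat) \<longrightarrow> S = {[]::nat list})" by simp
  next
    fix S :: "nat list set" and n :: nat
    assume "finite S \<and> S \<noteq> {} \<and> (n = 0 \<longrightarrow> S = {[]})"
    then show "\<exists>S'. (finite S' \<and> S' \<noteq> {} \<and> (Suc n = 0 \<longrightarrow> S' = {[]})) \<and>
        refines (U n) (from_nat n) S S'"
      using fusion_step[OF U(1) dense, of S n "from_nat n"] by simp
  qed
  then obtain S where "\<forall>n. (finite (S n) \<and> S n \<noteq> {} \<and> (n = 0 \<longrightarrow> S n = {[]})) \<and>
      refines (U n) (from_nat n) (S n) (S (Suc n))" ..
  then have S: "S n \<noteq> {}" "S 0 = {[]}" "refines (U n) (from_nat n) (S n) (S (Suc n))" for n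
    by simp_all
  have "\<forall>n. \<exists>k. \<forall>t\<in>S n. length t = k"
  proof
    fix n
    show "\<exists>k. \<forall>t\<in>S n. length t = k"
    proof (cases n)
      case 0
      then show ?thesis using S(2) by simp
    next
      case (Suc k)
      then show ?thesis using refines_end[OF S(3)[of k]] by auto
    qed
  qed
  from choice[OF this] obtain l where l: "\<And>n t. t \<in> S n \<Longrightarrow> length t = l n" by blast
  interpret fusion_fronts S l
    by standard (simp_all add: S(1) l refines_extends[OF S(3)])
  let ?T = "initial_segments (\<Union>k. S k)"
  have "perfect_tree ?T"
    using perfect_tree_fusion refines_splits[OF S(3)] by simp
  moreover have "slalom_tree ?T"
  proof (rule slalom_tree_fusion)
    fix \<sigma> :: "nat list"
    \<comment> \<open>\<open>\<sigma>\<close> is handled in the passage from front \<open>to_nat \<sigma>\<close> to the next one.\<close>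
    have "\<exists>m. \<forall>t\<in>S (Suc (to_nat \<sigma>)). length t = m + length \<sigma> \<and> drop m t = \<sigma>"
      using refines_end[OF S(3)[of "to_nat \<sigma>"]] by simp
    then show "\<exists>n m. \<forall>t\<in>S n. length t = m + length \<sigma> \<and> drop m t = \<sigma>" by (rule exI)
  qed
  moreover have "(x, y) \<in> G \<union> Id" if "x \<in> body ?T" "y \<in> body ?T" for x y
  proof (cases "x = y")
    case False
    have "(x, y) \<in> (\<Inter>n. U n)"
      using distinct_branches_mem_Inter[OF U(2) _ that False] refines_cylinders[OF S(3)] by simp
    then show ?thesis using U(3) by simp
  qed simp
  ultimately show ?thesis
    unfolding slalom_perfect_def by (intro exI[of _ "body ?T"]) auto
qed

end
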